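(* Let $G$ be a connected graph with $\mathsf{td}(G) = 3$. Then $\mathsf{mtd}(G) = 3$ if and only if $G$ contains none of $C_4$, $P_6$, $T_{3,3}$ as an induced subgraph.
   Context: $C_4$ is the 4-cycle, $P_6$ the path on 6 vertices, and $T_{3,3}$ the $(3,3)$-tadpole graph: a triangle $abc$ together with a path $a - x - y - z$ (6 vertices, 7 edges). An elimination tree of a connected graph $G$ is a rooted tree $(T,r)$ with $r\in V(G)$ whose root-subtrees are, recursively, elimination trees of the connected components of $G - r$; its depth is the maximum number of vertices on a root-to-leaf path; $\mathsf{td}(G)$ is the minimum depth of an elimination tree. A matched elimination tree is an elimination tree such that for every root-to-leaf path $(v_1,\dots,v_k)$: if $k$ is even, $v_1v_2, v_3v_4,\dots,v_{k-1}v_k$ are edges of $G$; if $k$ is odd, the sequence splits into consecutive blocks, all of size 2 except exactly one of size 3, where each size-2 block $(v_j,v_{j+1})$ has $v_jv_{j+1}\in E(G)$ and the size-3 block $(v_j,v_{j+1},v_{j+2})$ has $v_jv_{j+1},v_{j+1}v_{j+2}\in E(G)$. $\mathsf{mtd}(G)$ is the minimum depth of a matched elimination tree. *)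

theory Defs
  imports
    "Graph_Theory.Digraph_Component"
    "Graph_Theory.Digraph_Isomorphism"
    "HOL-Library.FSet"
    "HOL-Library.Extended_Nat"
begin

text \<open>
  Finite simple graphs are the library's \<open>graph\<close>s, i.e. finite symmetric digraphs without loops
  and parallel arcs, so that \<open>u \<rightarrow>\<^bsub>G\<^esub> v\<close> says that \<open>uv\<close> is an edge.
\<close>

definition components :: "('a, 'b) pre_digraph \<Rightarrow> ('a, 'b) pre_digraph set" where
  "components G = {C. pre_digraph.max_subgraph G connected C}"

datatype 'a rtree = Node 'a "'a rtree fset"

inductive elimination_tree :: "('a, 'b) pre_digraph \<Rightarrow> 'a rtree \<Rightarrow> bool" where
  "\<lbrakk> connected G; r \<in> verts G;
     bij_betw sub (components (pre_digraph.del_vert G r)) (fset ts);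
     \<forall>C \<in> components (pre_digraph.del_vert G r). elimination_tree C (sub C) \<rbrakk>
   \<Longrightarrow> elimination_tree G (Node r ts)"

inductive root_to_leaf_path :: "'a rtree \<Rightarrow> 'a list \<Rightarrow> bool" where
  leaf: "root_to_leaf_path (Node v {||}) [v]"
| step: "\<lbrakk> t |\<in>| ts; root_to_leaf_path t p \<rbrakk> \<Longrightarrow> root_to_leaf_path (Node v ts) (v # p)"

lemma ex_root_to_leaf_path: "\<exists>p. root_to_leaf_path t p"
proof (induction t)
  case (Node v ts)
  then show ?case
    by (cases "ts = {||}") (auto intro: root_to_leaf_path.intros)
qed

lemma finite_root_to_leaf_paths: "finite {p. root_to_leaf_path t p}"
proof (induction t)
  case (Node v ts)
  have "{p. root_to_leaf_path (Node v ts) p}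
      \<subseteq> insert [v] (\<Union>t \<in> fset ts. (#) v ` {p. root_to_leaf_path t p})"
    by (auto elim!: root_to_leaf_path.cases[of "Node v ts"])
  moreover have "finite (insert [v] (\<Union>t \<in> fset ts. (#) v ` {p. root_to_leaf_path t p}))"
    using Node by auto
  ultimately show ?case
    by (rule finite_subset)
qed

definition depth :: "'a rtree \<Rightarrow> nat" where
  "depth t = Max (length ` {p. root_to_leaf_path t p})"

definition edge_block :: "('a, 'b) pre_digraph \<Rightarrow> 'a list \<Rightarrow> bool" where
  "edge_block G b \<longleftrightarrow> (\<exists>u v. b = [u, v] \<and> u \<rightarrow>\<^bsub>G\<^esub> v)"

definition triple_block :: "('a, 'b) pre_digraph \<Rightarrow> 'a list \<Rightarrow> bool" where
  "triple_block G b \<longleftrightarrow> (\<exists>u v w. b = [u, v, w] \<and> u \<rightarrow>\<^bsub>G\<^esub> v \<and> v \<rightarrow>\<^bsub>G\<^esub> w)"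

text \<open>
  The even case asks for the edges \<open>v\<^sub>1v\<^sub>2, v\<^sub>3v\<^sub>4, \<dots>\<close>, list positions being counted from 0.
  In the odd case \<open>bs @ b # cs\<close> is the sequence of blocks, and \<open>b\<close> the one of size 3.
\<close>

definition matched_path :: "('a, 'b) pre_digraph \<Rightarrow> 'a list \<Rightarrow> bool" where
  "matched_path G p \<longleftrightarrow>
    (if even (length p)
     then \<forall>i < length p div 2. p ! (2 * i) \<rightarrow>\<^bsub>G\<^esub> p ! (2 * i + 1)
     else \<exists>bs b cs. p = concat (bs @ b # cs) \<and> triple_block G b \<and>
            (\<forall>c \<in> set bs \<union> set cs. edge_block G c))"

definition matched_elimination_tree :: "('a, 'b) pre_digraph \<Rightarrow> 'a rtree \<Rightarrow> bool" where
  "matched_elimination_tree G t \<longleftrightarrow>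
    elimination_tree G t \<and> (\<forall>p. root_to_leaf_path t p \<longrightarrow> matched_path G p)"

text \<open>
  The minima are taken in \<^typ>\<open>enat\<close>, so that the parameter is \<open>\<infinity>\<close> if there is no such tree
  (a one-vertex graph has no matched elimination tree).
\<close>

definition td :: "('a, 'b) pre_digraph \<Rightarrow> enat" where
  "td G = (INF t \<in> {t. elimination_tree G t}. enat (depth t))"

definition mtd :: "('a, 'b) pre_digraph \<Rightarrow> enat" where
  "mtd G = (INF t \<in> {t. matched_elimination_tree G t}. enat (depth t))"

definition simple_graph :: "nat set \<Rightarrow> (nat \<times> nat) set \<Rightarrow> (nat, nat \<times> nat) pre_digraph" where
  "simple_graph V E = with_proj \<lparr> pverts = V, parcs = E \<union> E\<inverse> \<rparr>"

definition C4 :: "(nat, nat \<times> nat) pre_digraph" where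
  "C4 = simple_graph {0..<4} {(0, 1), (1, 2), (2, 3), (3, 0)}"

definition P6 :: "(nat, nat \<times> nat) pre_digraph" where
  "P6 = simple_graph {0..<6} {(0, 1), (1, 2), (2, 3), (3, 4), (4, 5)}"

text \<open>The triangle is \<open>0, 1, 2\<close> and the pendant path \<open>0, 3, 4, 5\<close>.\<close>

definition T33 :: "(nat, nat \<times> nat) pre_digraph" where
  "T33 = simple_graph {0..<6} {(0, 1), (1, 2), (2, 0), (0, 3), (3, 4), (4, 5)}"

definition contains_induced :: "('a, 'b) pre_digraph \<Rightarrow> ('c, 'd) pre_digraph \<Rightarrow> bool" where
  "contains_induced G F \<longleftrightarrow> (\<exists>H. induced_subgraph H G \<and> digraph_iso H F)"

end

theory Submission
  imports Defs
begin

text \<open>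
  A connected graph \<open>G\<close> has an elimination tree of depth at most 3 with root \<open>r\<close> iff every component
  of \<open>G - r\<close> is a star. The tree can be chosen to be matched iff, moreover, each of these stars has a
  centre adjacent to \<open>r\<close> (and \<open>G\<close> has another vertex than \<open>r\<close>). Such an \<open>r\<close> lies on every triangle
  and on every path with four vertices, and it is adjacent to the middle vertex of every path with
  three vertices that avoids it; no vertex of \<open>G\<close> can do this if \<open>G\<close> contains an induced \<open>C\<^sub>4\<close>, \<open>P\<^sub>6\<close>
  or \<open>T\<^sub>3\<^sub>,\<^sub>3\<close>.

  Conversely, suppose that all components of \<open>G - r\<close> are stars, but one of them, \<open>C\<close>, has no centre
  adjacent to \<open>r\<close>. Let \<open>c\<close> be a centre of \<open>C\<close>. As \<open>G\<close> has no induced \<open>C\<^sub>4\<close>, exactly one leaf \<open>l\<close>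
  of \<open>C\<close> is adjacent to \<open>r\<close>. With another leaf \<open>l'\<close>, the path \<open>r - l - c - l'\<close> is induced, and an edge in
  another component of \<open>G - r\<close> would extend it to an induced \<open>P\<^sub>6\<close> or \<open>T\<^sub>3\<^sub>,\<^sub>3\<close>. Hence \<open>G - l\<close> consists
  of a star around \<open>r\<close> and a star around \<open>c\<close>, and both centres are adjacent to \<open>l\<close>.
\<close>

unbundle no funcset_syntax

subsection \<open>Components\<close>

lemma induced_subgraph_dominates_iff:
  assumes "induced_subgraph H G"
  shows "u \<rightarrow>\<^bsub>H\<^esub> v \<longleftrightarrow> u \<rightarrow>\<^bsub>G\<^esub> v \<and> u \<in> verts H \<and> v \<in> verts H"
proof -
  have "tail H = tail G" "head H = head G"
    using assms by (auto simp: induced_subgraph_def subgraph_def compatible_def)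
  then show ?thesis
    using assms by (auto simp: arcs_ends_conv induced_subgraph_def)
qed

lemma (in wf_digraph) induced_subgraph_del_vert: "induced_subgraph (del_vert v) G"
  using subgraph_del_vert by (rule induced_subgraphI) (auto simp: del_vert_simps)

lemma (in graph) graphI_induced:
  assumes "induced_subgraph H G"
  shows "graph H"
proof (rule digraph.graphI)
  show "digraph H"
    using assms by (rule digraphI_induced)
  show "symmetric H"
    using sym_arcs assms by (rule induced_graph_imp_symmetric)
qed

lemma strongly_connected_imp_connected:
  assumes "strongly_connected G"
  shows "connected G"
proof -
  have "arcs_ends G \<subseteq> arcs_ends (mk_symmetric G)"
    by (auto simp: arcs_ends_conv parcs_mk_symmetric)
  then show ?thesis
    using assms rtrancl_on_mono[of "arcs_ends G" _ "verts G"]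
    unfolding connected_def strongly_connected_def reachable_def
    by (metis order_refl pverts_mk_symmetric with_proj_simps(1))
qed

lemma arc_mono_connected: "arc_mono connected"
  unfolding arc_mono_def
  by (metis spanning_def subgraphE wf_digraph.connected_spanning_imp_connected)

lemma subgraph_antisym: "subgraph G H \<Longrightarrow> subgraph H G \<Longrightarrow> G = H"
  by (auto simp: subgraph_def compatible_def)

context sym_digraph
begin

lemma dominates_commute: "u \<rightarrow> v \<longleftrightarrow> v \<rightarrow> u"
  using graph_symmetric by blast

lemma connected_iff_strongly_connected: "connected G \<longleftrightarrow> strongly_connected G"
  using symmetric_connected_imp_strongly_connected strongly_connected_imp_connected by blast

lemma connected_induct [consumes 3, case_names base step]:
  assumes "connected G" "u \<in> verts G" "v \<in> verts G"
    and "P u" "\<And>x y. x \<rightarrow> y \<Longrightarrow> P x \<Longrightarrow> P y"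
  shows "P v"
proof -
  have "u \<rightarrow>\<^sup>* v"
    using assms(1-3) by (auto simp: connected_iff_strongly_connected)
  then show ?thesis
    by (induction rule: reachable_induct) (use assms in auto)
qed

lemma ex_dominates_if_connected:
  assumes "connected G" "\<not> is_singleton (verts G)" "u \<in> verts G"
  shows "\<exists>v. u \<rightarrow> v"
proof (rule ccontr)
  assume "\<nexists>v. u \<rightarrow> v"
  then have "v = u" if "v \<in> verts G" for v
    using connected_induct[OF assms(1,3) that, of "\<lambda>v. v = u"] by blast
  then show False
    using assms(2,3) by (auto simp: is_singleton_def)
qed

lemma max_subgraph_connected_iff:
  "max_subgraph connected H \<longleftrightarrow> max_subgraph strongly_connected H"
proof
  assume max: "max_subgraph connected H"
  then have "induced_subgraph H G"
    using arc_mono_connected by (rule induced_subgraphI_arc_mono)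
  then have "strongly_connected H"
    using max max_subgraph_prop induced_graph_imp_graph sym_digraph.connected_iff_strongly_connected
    by blast
  then show "max_subgraph strongly_connected H"
    using max max_subgraph_mp strongly_connected_imp_connected by blast
next
  assume max: "max_subgraph strongly_connected H"
  show "max_subgraph connected H"
  proof (rule max_subgraphI)
    fix H' assume H': "H \<noteq> H'" "subgraph H H'" "subgraph H' G"
    let ?K = "G \<restriction> verts H'"
    have K: "subgraph H' ?K" "subgraph ?K G"
      using H'(3) by (auto simp: subgraph_induce_subgraphI2 subgraph_induce_subgraphI)
    interpret K: sym_digraph ?K
      using H'(3) by (auto intro: induced_graph_imp_graph)
    show "\<not> connected H'"
    proof
      assume "connected H'"
      then have "strongly_connected ?K"
        using K(1) K.connected_iff_strongly_connected arc_mono_connected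
        unfolding arc_mono_def by (metis induce_subgraph_verts)
      then have "?K = H"
        using max K H'(2) subgraph_trans unfolding max_subgraph_def by metis
      then show False
        using K(1) H'(1,2) subgraph_antisym by metis
    qed
  qed (use max strongly_connected_imp_connected in \<open>auto simp: max_subgraph_def\<close>)
qed

lemma components_eq_sccs: "components G = sccs"
  by (simp add: components_def sccs_altdef2 max_subgraph_connected_iff)

lemma component_induced: "C \<in> components G \<Longrightarrow> induced_subgraph C G"
  by (simp add: components_eq_sccs in_sccs_imp_induced)

lemma component_connected: "C \<in> components G \<Longrightarrow> connected C"
  by (auto simp: components_def max_subgraph_prop)

lemma component_nonempty: "C \<in> components G \<Longrightarrow> verts C \<noteq> {}"
  by (auto simp: components_eq_sccs sccs_def strongly_connected_def)

lemma component_closed: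
  assumes "C \<in> components G" "u \<in> verts C" "u \<rightarrow> v"
  shows "v \<in> verts C"
proof -
  have "verts C \<in> sccs_verts"
    using assms(1) by (auto simp: components_eq_sccs intro: in_sccs_vertsI_sccs)
  moreover have "u \<rightarrow>\<^sup>* v" "v \<rightarrow>\<^sup>* u"
    using assms(3) graph_symmetric by blast+
  ultimately show ?thesis
    using assms(2) by (auto simp: in_sccs_verts_conv_reachable)
qed

lemma ex_component: "v \<in> verts G \<Longrightarrow> \<exists>C\<in>components G. v \<in> verts C"
  using scc_for_vert_ex by (auto simp: components_eq_sccs)

lemma component_unique:
  "C \<in> components G \<Longrightarrow> D \<in> components G \<Longrightarrow> v \<in> verts C \<Longrightarrow> v \<in> verts D \<Longrightarrow> C = D"
  using scc_disj by (auto simp: components_eq_sccs)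

lemma components_eq_empty_iff: "components G = {} \<longleftrightarrow> verts G = {}"
proof
  show "verts G = {}" if "components G = {}"
    using that ex_component by blast
  show "components G = {}" if "verts G = {}"
    using that component_nonempty component_induced subgraph_imp_subverts by blast
qed

end

lemma (in graph) finite_components: "finite (components G)"
  using finite_sccs_verts inj_on_verts_sccs
  by (simp add: components_eq_sccs sccs_verts_conv finite_image_iff)

locale vertex_deletion = graph G for G :: "('a, 'b) pre_digraph" (structure) +
  fixes r :: 'a
begin

abbreviation comps :: "('a, 'b) pre_digraph set" where
  "comps \<equiv> components (del_vert r)"

sublocale del: graph "del_vert r"
  using induced_subgraph_del_vert by (rule graphI_induced)

lemma dominates_del_vert_iff: "u \<rightarrow>\<^bsub>del_vert r\<^esub> v \<longleftrightarrow> u \<rightarrow> v \<and> u \<noteq> r \<and> v \<noteq> r"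
  using adj_in_verts
  by (auto simp: induced_subgraph_dominates_iff[OF induced_subgraph_del_vert] del_vert_simps)

lemma comp_subset: "C \<in> comps \<Longrightarrow> verts C \<subseteq> verts G - {r}"
  using subgraph_imp_subverts[OF induced_imp_subgraph[OF del.component_induced]]
  by (simp add: del_vert_simps)

lemma comp_graph: "C \<in> comps \<Longrightarrow> graph C"
  using del.component_induced by (rule del.graphI_induced)

lemma comp_connected: "C \<in> comps \<Longrightarrow> connected C"
  by (rule del.component_connected)

lemma comp_dominates_iff:
  assumes "C \<in> comps"
  shows "u \<rightarrow>\<^bsub>C\<^esub> v \<longleftrightarrow> u \<rightarrow> v \<and> u \<in> verts C \<and> v \<in> verts C"
  using comp_subset[OF assms]
  by (auto simp: induced_subgraph_dominates_iff[OF del.component_induced[OF assms]]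
      dominates_del_vert_iff)

lemma ex_comp: "v \<in> verts G \<Longrightarrow> v \<noteq> r \<Longrightarrow> \<exists>C\<in>comps. v \<in> verts C"
  using del.ex_component by (simp add: del_vert_simps)

lemma comp_closed: "C \<in> comps \<Longrightarrow> u \<in> verts C \<Longrightarrow> u \<rightarrow> v \<Longrightarrow> v \<noteq> r \<Longrightarrow> v \<in> verts C"
  using del.component_closed comp_subset dominates_del_vert_iff by blast

lemma comp_separated:
  assumes "C \<in> comps" "D \<in> comps" "C \<noteq> D" "u \<in> verts C" "v \<in> verts D"
  shows "u \<noteq> v" "\<not> u \<rightarrow> v"
  using assms comp_closed del.component_unique comp_subset by blast+

lemma ex_comp_dominates:
  assumes "u \<rightarrow> v" "u \<noteq> r" "v \<noteq> r"
  shows "\<exists>C\<in>comps. u \<rightarrow>\<^bsub>C\<^esub> v"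
  using assms ex_comp comp_closed comp_dominates_iff adj_in_verts by metis

lemma ex_dominated_in_comp:
  assumes "connected G" "r \<in> verts G" "C \<in> comps"
  shows "\<exists>v\<in>verts C. r \<rightarrow> v"
proof (rule ccontr)
  assume no_neighbor: "\<not> (\<exists>v\<in>verts C. r \<rightarrow> v)"
  obtain u where "u \<in> verts C"
    using del.component_nonempty[OF assms(3)] by blast
  then have "u \<in> verts G"
    using comp_subset[OF assms(3)] by blast
  with assms(1) have "r \<in> verts C"
    using assms(2)
  proof (induction rule: connected_induct)
    case base
    show ?case by fact
  next
    case (step x y)
    then show ?case
      using no_neighbor comp_closed[OF assms(3)] dominates_commute by metis
  qed
  then show False
    using comp_subset[OF assms(3)] by blast
qed

lemma singleton_comp_dominates_iff:
  assumes "connected G" "r \<in> verts G" "C \<in> comps" "verts C = {v}"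
  shows "v \<rightarrow> u \<longleftrightarrow> u = r"
  using ex_dominated_in_comp[OF assms(1-3)] comp_closed[OF assms(3)] assms(4)
    dominates_commute adj_not_same
  by (metis singletonD singletonI)

end

subsection \<open>Stars\<close>

definition star_center :: "('a, 'b) pre_digraph \<Rightarrow> 'a \<Rightarrow> bool" where
  "star_center G c \<longleftrightarrow> c \<in> verts G \<and> (\<forall>u v. u \<rightarrow>\<^bsub>G\<^esub> v \<longrightarrow> u = c \<or> v = c)"

context graph
begin

lemma star_center_dominates_iff:
  assumes "connected G" "star_center G c" "u \<in> verts G" "v \<in> verts G"
  shows "u \<rightarrow> v \<longleftrightarrow> (u = c) \<noteq> (v = c)"
proof -
  have spoke: "c \<rightarrow> w" if "w \<in> verts G" "w \<noteq> c" for w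
  proof -
    have "c \<in> verts G"
      using assms(2) by (simp add: star_center_def)
    then have "w = c \<or> c \<rightarrow> w"
      using connected_induct[OF assms(1) _ that(1), of c "\<lambda>w. w = c \<or> c \<rightarrow> w"] assms(2)
      unfolding star_center_def by blast
    then show ?thesis
      using that(2) by blast
  qed
  then show ?thesis
    using assms(2-4) dominates_commute adj_not_same unfolding star_center_def by metis
qed

end

lemma (in vertex_deletion) comp_star_center_dominates_iff:
  assumes "C \<in> comps" "star_center C c" "u \<in> verts C" "v \<in> verts C"
  shows "u \<rightarrow> v \<longleftrightarrow> (u = c) \<noteq> (v = c)"
  using graph.star_center_dominates_iff[OF comp_graph comp_connected] comp_dominates_iff assms
  by metis

context graph
begin

lemma star_center_iff_components_singleton:
  assumes "c \<in> verts G"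
  shows "star_center G c \<longleftrightarrow> (\<forall>C\<in>components (del_vert c). is_singleton (verts C))"
proof -
  interpret vertex_deletion G c
    by unfold_locales
  show ?thesis
  proof (intro iffI ballI)
    fix C assume star: "star_center G c" and C: "C \<in> comps"
    interpret C: graph C
      using C by (rule comp_graph)
    obtain u where "u \<in> verts C"
      using del.component_nonempty[OF C] by blast
    then show "is_singleton (verts C)"
      using C.ex_dominates_if_connected[OF comp_connected[OF C]] star comp_subset[OF C]
      unfolding comp_dominates_iff[OF C] star_center_def by blast
  next
    assume singleton: "\<forall>C\<in>comps. is_singleton (verts C)"
    have "u = c \<or> v = c" if "u \<rightarrow> v" for u v
      using ex_comp_dominates[OF that] singleton comp_dominates_iff adj_not_same that
      by (metis is_singletonE singletonD)
    then show "star_center G c"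
      using assms by (simp add: star_center_def)
  qed
qed

lemma ex_star_center_component:
  assumes indep: "\<And>s s'. s \<in> S \<Longrightarrow> s' \<in> S \<Longrightarrow> \<not> s \<rightarrow> s'"
    and leaf: "\<And>v. v \<in> verts G - S \<Longrightarrow> \<exists>s\<in>S. \<forall>u. v \<rightarrow> u \<longleftrightarrow> u = s"
    and C: "C \<in> components G"
  shows "\<exists>s\<in>S. star_center C s"
proof -
  interpret C: graph C
    using component_induced[OF C] by (rule graphI_induced)
  have sub: "verts C \<subseteq> verts G"
    using component_induced[OF C] subgraph_imp_subverts by blast
  have dom: "u \<rightarrow>\<^bsub>C\<^esub> v \<longleftrightarrow> u \<rightarrow> v \<and> u \<in> verts C \<and> v \<in> verts C" for u v
    using component_induced[OF C] by (rule induced_subgraph_dominates_iff)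
  obtain v where v: "v \<in> verts C"
    using component_nonempty[OF C] by blast
  obtain s where s: "s \<in> S" "s \<in> verts C"
    using leaf[of v] component_closed[OF C v] v sub by blast
  have reach: "w = s \<or> w \<notin> S \<and> w \<rightarrow> s" if "w \<in> verts C" for w
    using component_connected[OF C] s(2) that
  proof (induction rule: C.connected_induct)
    case base
    show ?case by simp
  next
    case (step x y)
    then show ?case
      using leaf[of x] indep s sub unfolding dom by (metis DiffI dominates_commute subsetD)
  qed
  have "x = s \<or> y = s" if "x \<rightarrow>\<^bsub>C\<^esub> y" for x y
    using that reach[of x] leaf[of x] sub unfolding dom by (metis DiffI subsetD)
  then show ?thesis
    using s by (auto simp: star_center_def)
qed

end

subsection \<open>Elimination trees of depth at most 3\<close>

primrec root_vert :: "'a rtree \<Rightarrow> 'a" where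
  "root_vert (Node v ts) = v"

lemma ex_rtree_iff: "(\<exists>t. P t) \<longleftrightarrow> (\<exists>v ts. P (Node v ts))"
  by (metis rtree.exhaust)

lemma root_to_leaf_path_Node_iff:
  "root_to_leaf_path (Node v ts) p \<longleftrightarrow>
    ts = {||} \<and> p = [v] \<or> (\<exists>t\<in>fset ts. \<exists>q. root_to_leaf_path t q \<and> p = v # q)"
  by (subst root_to_leaf_path.simps) auto

lemma depth_le_iff: "depth t \<le> n \<longleftrightarrow> (\<forall>p. root_to_leaf_path t p \<longrightarrow> length p \<le> n)"
  using finite_root_to_leaf_paths[of t] ex_root_to_leaf_path[of t]
  unfolding depth_def by (subst Max_le_iff) auto

lemma depth_Node_le_Suc_iff: "depth (Node v ts) \<le> Suc n \<longleftrightarrow> (\<forall>t\<in>fset ts. depth t \<le> n)"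
  by (force simp: depth_le_iff root_to_leaf_path_Node_iff)

lemma depth_neq_0: "depth t \<noteq> 0"
proof -
  have "\<not> depth t \<le> 0"
    using ex_root_to_leaf_path[of t] unfolding depth_le_iff
    by (cases t) (auto simp: root_to_leaf_path_Node_iff)
  then show ?thesis
    by simp
qed

lemma root_to_leaf_path_Cons: "root_to_leaf_path t p \<Longrightarrow> \<exists>q. p = root_vert t # q"
  by (cases t) (auto simp: root_to_leaf_path_Node_iff)

lemma elimination_tree_root_vert: "elimination_tree G t \<Longrightarrow> root_vert t \<in> verts G"
  by (auto elim: elimination_tree.cases)

context graph
begin

lemma ex_elimination_tree_Node_iff:
  "(\<exists>ts. elimination_tree G (Node r ts) \<and> (\<forall>t\<in>fset ts. P t)) \<longleftrightarrow>
    connected G \<and> r \<in> verts G \<and> (\<forall>C\<in>components (del_vert r). \<exists>t. elimination_tree C t \<and> P t)"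
    (is "?tree \<longleftrightarrow> ?subtrees")
proof
  assume ?tree
  then obtain ts where "elimination_tree G (Node r ts)" and P: "\<forall>t\<in>fset ts. P t"
    by blast
  then show ?subtrees
    by (cases rule: elimination_tree.cases) (metis P bij_betw_apply)
next
  interpret vertex_deletion G r
    by unfold_locales
  assume ?subtrees
  then obtain sub where sub: "\<forall>C\<in>comps. elimination_tree C (sub C) \<and> P (sub C)"
    by metis
  define ts where "ts = Abs_fset (sub ` comps)"
  have ts: "fset ts = sub ` comps"
    using del.finite_components by (simp add: ts_def Abs_fset_inverse)
  moreover have "inj_on sub comps"
    using sub by (intro inj_onI) (metis del.component_unique elimination_tree_root_vert)
  ultimately have "elimination_tree G (Node r ts)"
    using \<open>?subtrees\<close> sub by (intro elimination_tree.intros[of _ _ sub]) (auto simp: bij_betw_def)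
  moreover have "\<forall>t\<in>fset ts. P t"
    using sub ts by simp
  ultimately show ?tree
    by blast
qed

lemma elimination_tree_subtree:
  assumes "elimination_tree G (Node r ts)" "t |\<in>| ts"
  shows "\<exists>C\<in>components (del_vert r). elimination_tree C t"
  using assms by (cases rule: elimination_tree.cases) (metis bij_betw_imp_surj_on imageE)

lemma elimination_tree_Node_empty_iff:
  assumes "elimination_tree G (Node r ts)"
  shows "ts = {||} \<longleftrightarrow> verts G = {r}"
proof -
  interpret vertex_deletion G r
    by unfold_locales
  obtain sub where "r \<in> verts G" "bij_betw sub comps (fset ts)"
    using assms by (auto elim: elimination_tree.cases)
  then have "ts = {||} \<longleftrightarrow> comps = {}"
    by (metis bij_betw_empty1 bij_betw_empty2 bot_fset.rep_eq fset_inject)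
  also have "\<dots> \<longleftrightarrow> verts G = {r}"
    using \<open>r \<in> verts G\<close> by (auto simp: del.components_eq_empty_iff del_vert_simps)
  finally show ?thesis .
qed

lemma ex_elimination_tree_Node_depth_le_1_iff:
  "(\<exists>ts. elimination_tree G (Node r ts) \<and> depth (Node r ts) \<le> 1) \<longleftrightarrow>
    connected G \<and> verts G = {r}"
proof -
  interpret vertex_deletion G r
    by unfold_locales
  have "(\<exists>ts. elimination_tree G (Node r ts) \<and> depth (Node r ts) \<le> 1) \<longleftrightarrow>
      (\<exists>ts. elimination_tree G (Node r ts) \<and> (\<forall>t\<in>fset ts. False))"
    by (simp add: depth_Node_le_Suc_iff[of _ _ 0, simplified] depth_neq_0)
  also have "\<dots> \<longleftrightarrow> connected G \<and> r \<in> verts G \<and> comps = {}"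
    unfolding ex_elimination_tree_Node_iff by auto
  also have "\<dots> \<longleftrightarrow> connected G \<and> verts G = {r}"
    by (auto simp: del.components_eq_empty_iff del_vert_simps)
  finally show ?thesis .
qed

lemma ex_elimination_tree_Node_depth_le_2_iff:
  "(\<exists>ts. elimination_tree G (Node c ts) \<and> depth (Node c ts) \<le> 2) \<longleftrightarrow>
    connected G \<and> star_center G c"
proof -
  interpret vertex_deletion G c
    by unfold_locales
  have singleton: "(\<exists>t. elimination_tree C t \<and> depth t \<le> 1) \<longleftrightarrow> is_singleton (verts C)"
    if "C \<in> comps" for C
    using graph.ex_elimination_tree_Node_depth_le_1_iff[OF comp_graph[OF that]]
      comp_connected[OF that]
    unfolding ex_rtree_iff is_singleton_def by blast
  have "(\<exists>ts. elimination_tree G (Node c ts) \<and> depth (Node c ts) \<le> 2) \<longleftrightarrow>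
      (\<exists>ts. elimination_tree G (Node c ts) \<and> (\<forall>t\<in>fset ts. depth t \<le> 1))"
    by (simp only: numeral_2_eq_2 One_nat_def depth_Node_le_Suc_iff)
  also have "\<dots> \<longleftrightarrow> connected G \<and> c \<in> verts G \<and> (\<forall>C\<in>comps. is_singleton (verts C))"
    unfolding ex_elimination_tree_Node_iff using singleton by blast
  also have "\<dots> \<longleftrightarrow> connected G \<and> star_center G c"
    using star_center_iff_components_singleton by (auto simp: star_center_def)
  finally show ?thesis .
qed

lemma ex_elimination_tree_depth_le_2_iff:
  assumes "connected G"
  shows "(\<exists>t. elimination_tree G t \<and> depth t \<le> 2 \<and> P (root_vert t)) \<longleftrightarrow>
    (\<exists>c. star_center G c \<and> P c)"
  using assms ex_elimination_tree_Node_depth_le_2_iff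
  unfolding ex_rtree_iff root_vert.simps by metis

lemma elimination_tree_depth_le_2_path:
  assumes "elimination_tree G t" "depth t \<le> 2" "root_to_leaf_path t p"
  shows "p = [root_vert t] \<or> (\<exists>l. p = [root_vert t, l] \<and> root_vert t \<rightarrow> l)"
proof (cases t)
  case (Node c ts)
  interpret vertex_deletion G c
    by unfold_locales
  consider (leaf) "p = [c]" | (subtree) s q where "s |\<in>| ts" "root_to_leaf_path s q" "p = c # q"
    using assms(3) by (auto simp: Node root_to_leaf_path_Node_iff)
  then show ?thesis
  proof cases
    case leaf
    then show ?thesis
      by (simp add: Node)
  next
    case (subtree s q)
    have "depth s \<le> 1"
      using assms(2) subtree(1) depth_Node_le_Suc_iff[of c ts 1] by (simp add: Node numeral_2_eq_2)
    then have "q = [root_vert s]"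
      using subtree(2) root_to_leaf_path_Cons[of s q] by (auto simp: depth_le_iff)
    moreover obtain C where C: "C \<in> comps" "elimination_tree C s"
      using elimination_tree_subtree assms(1) subtree(1) Node by blast
    then have "root_vert s \<in> verts G" "root_vert s \<noteq> c"
      using elimination_tree_root_vert comp_subset by blast+
    then have "c \<rightarrow> root_vert s"
      using star_center_dominates_iff[of c c "root_vert s"] assms(1,2)
        ex_elimination_tree_Node_depth_le_2_iff[of c]
      by (auto simp: Node star_center_def)
    ultimately show ?thesis
      using subtree(3) by (simp add: Node)
  qed
qed

end

definition star_root :: "('a, 'b) pre_digraph \<Rightarrow> 'a \<Rightarrow> bool" where
  "star_root G r \<longleftrightarrow> r \<in> verts G \<and>
    (\<forall>C\<in>components (pre_digraph.del_vert G r). \<exists>c. star_center C c)"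

definition matched_star_root :: "('a, 'b) pre_digraph \<Rightarrow> 'a \<Rightarrow> bool" where
  "matched_star_root G r \<longleftrightarrow> r \<in> verts G \<and>
    (\<forall>C\<in>components (pre_digraph.del_vert G r). \<exists>c. star_center C c \<and> r \<rightarrow>\<^bsub>G\<^esub> c)"

lemma matched_path_single: "\<not> matched_path G [v]"
proof
  assume "matched_path G [v]"
  then obtain bs b cs where "[v] = concat (bs @ b # cs)" "triple_block G b"
    by (auto simp: matched_path_def)
  then have "length [v] \<ge> length b" "length b = 3"
    by (auto simp: triple_block_def)
  then show False
    by simp
qed

lemma matched_path_pair_iff: "matched_path G [u, v] \<longleftrightarrow> u \<rightarrow>\<^bsub>G\<^esub> v"
  by (simp add: matched_path_def)

lemma matched_path_triple_iff: "matched_path G [u, v, w] \<longleftrightarrow> u \<rightarrow>\<^bsub>G\<^esub> v \<and> v \<rightarrow>\<^bsub>G\<^esub> w"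
proof
  assume "matched_path G [u, v, w]"
  then obtain bs b cs where p: "[u, v, w] = concat (bs @ b # cs)" and b: "triple_block G b"
    by (auto simp: matched_path_def)
  have "length b = 3"
    using b by (auto simp: triple_block_def)
  moreover have "length [u, v, w] = length (concat bs) + length b + length (concat cs)"
    unfolding p by simp
  ultimately have "concat bs = []" "concat cs = []"
    by simp_all
  then have "b = [u, v, w]"
    using p by (metis append_Nil append_Nil2 concat.simps(2) concat_append)
  then show "u \<rightarrow>\<^bsub>G\<^esub> v \<and> v \<rightarrow>\<^bsub>G\<^esub> w"
    using b by (simp add: triple_block_def)
next
  assume "u \<rightarrow>\<^bsub>G\<^esub> v \<and> v \<rightarrow>\<^bsub>G\<^esub> w"
  then show "matched_path G [u, v, w]"
    unfolding matched_path_def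
    by (auto simp: triple_block_def intro!: exI[of _ "[]"] exI[of _ "[u, v, w]"])
qed

context graph
begin

lemma matched_path_Cons_iff_root_dominates:
  assumes "elimination_tree G (Node r ts)" "depth (Node r ts) \<le> 3"
    and t: "t |\<in>| ts" and q: "root_to_leaf_path t q"
  shows "matched_path G (r # q) \<longleftrightarrow> r \<rightarrow> root_vert t"
proof -
  interpret vertex_deletion G r
    by unfold_locales
  obtain C where C: "C \<in> comps" "elimination_tree C t"
    using elimination_tree_subtree[OF assms(1) t] by blast
  moreover have "depth t \<le> 2"
    using assms(2) t depth_Node_le_Suc_iff[of r ts 2] by simp
  ultimately have "q = [root_vert t] \<or> (\<exists>l. q = [root_vert t, l] \<and> root_vert t \<rightarrow>\<^bsub>C\<^esub> l)"
    using graph.elimination_tree_depth_le_2_path comp_graph q by blast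
  then show ?thesis
    by (auto simp: matched_path_pair_iff matched_path_triple_iff comp_dominates_iff[OF C(1)])
qed

lemma matched_elimination_tree_iff_root_dominates:
  assumes "elimination_tree G (Node r ts)" "depth (Node r ts) \<le> 3"
  shows "matched_elimination_tree G (Node r ts) \<longleftrightarrow>
    ts \<noteq> {||} \<and> (\<forall>t\<in>fset ts. r \<rightarrow> root_vert t)"
proof -
  note matched = matched_path_Cons_iff_root_dominates[OF assms]
  show ?thesis
  proof
    assume "matched_elimination_tree G (Node r ts)"
    then have path: "matched_path G p" if "root_to_leaf_path (Node r ts) p" for p
      using that by (simp add: matched_elimination_tree_def)
    have "ts \<noteq> {||}"
      using path[of "[r]"] matched_path_single[of G r] by (auto simp: root_to_leaf_path_Node_iff)
    moreover have "r \<rightarrow> root_vert t" if t: "t |\<in>| ts" for t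
    proof -
      obtain q where q: "root_to_leaf_path t q"
        using ex_root_to_leaf_path by blast
      then have "root_to_leaf_path (Node r ts) (r # q)"
        using t by (intro root_to_leaf_path.step)
      then show ?thesis
        using path matched[OF t q] by blast
    qed
    ultimately show "ts \<noteq> {||} \<and> (\<forall>t\<in>fset ts. r \<rightarrow> root_vert t)"
      by blast
  next
    assume "ts \<noteq> {||} \<and> (\<forall>t\<in>fset ts. r \<rightarrow> root_vert t)"
    then have "matched_path G p" if "root_to_leaf_path (Node r ts) p" for p
      using that matched by (auto simp: root_to_leaf_path_Node_iff)
    then show "matched_elimination_tree G (Node r ts)"
      using assms(1) by (simp add: matched_elimination_tree_def)
  qed
qed

lemma ex_elimination_tree_Node_depth_le_3_iff:
  "(\<exists>ts. elimination_tree G (Node r ts) \<and> depth (Node r ts) \<le> 3) \<longleftrightarrow>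
    connected G \<and> star_root G r"
proof -
  interpret vertex_deletion G r
    by unfold_locales
  have star: "(\<exists>t. elimination_tree C t \<and> depth t \<le> 2) \<longleftrightarrow> (\<exists>c. star_center C c)"
    if "C \<in> comps" for C
    using that graph.ex_elimination_tree_depth_le_2_iff[OF comp_graph comp_connected,
        of C "\<lambda>_. True"]
    by simp
  have "(\<exists>ts. elimination_tree G (Node r ts) \<and> depth (Node r ts) \<le> 3) \<longleftrightarrow>
      (\<exists>ts. elimination_tree G (Node r ts) \<and> (\<forall>t\<in>fset ts. depth t \<le> 2))"
    by (simp only: numeral_3_eq_3 numeral_2_eq_2 depth_Node_le_Suc_iff)
  also have "\<dots> \<longleftrightarrow> connected G \<and> star_root G r"
    unfolding ex_elimination_tree_Node_iff star_root_def using star by blast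
  finally show ?thesis .
qed

lemma ex_matched_elimination_tree_Node_depth_le_3_iff:
  "(\<exists>ts. matched_elimination_tree G (Node r ts) \<and> depth (Node r ts) \<le> 3) \<longleftrightarrow>
    connected G \<and> verts G \<noteq> {r} \<and> matched_star_root G r"
proof -
  interpret vertex_deletion G r
    by unfold_locales
  have star: "(\<exists>t. elimination_tree C t \<and> depth t \<le> 2 \<and> r \<rightarrow> root_vert t) \<longleftrightarrow>
      (\<exists>c. star_center C c \<and> r \<rightarrow> c)" if "C \<in> comps" for C
    using that by (intro graph.ex_elimination_tree_depth_le_2_iff comp_graph comp_connected)
  have "matched_elimination_tree G (Node r ts) \<and> depth (Node r ts) \<le> 3 \<longleftrightarrow>
      verts G \<noteq> {r} \<and>
      elimination_tree G (Node r ts) \<and> (\<forall>t\<in>fset ts. depth t \<le> 2 \<and> r \<rightarrow> root_vert t)" for ts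
    using matched_elimination_tree_iff_root_dominates[of r ts] depth_Node_le_Suc_iff[of r ts 2]
      elimination_tree_Node_empty_iff[of r ts]
    by (auto simp: matched_elimination_tree_def)
  then have "(\<exists>ts. matched_elimination_tree G (Node r ts) \<and> depth (Node r ts) \<le> 3) \<longleftrightarrow>
      verts G \<noteq> {r} \<and>
      (\<exists>ts. elimination_tree G (Node r ts) \<and> (\<forall>t\<in>fset ts. depth t \<le> 2 \<and> r \<rightarrow> root_vert t))"
    by blast
  also have "\<dots> \<longleftrightarrow> connected G \<and> verts G \<noteq> {r} \<and> matched_star_root G r"
    unfolding ex_elimination_tree_Node_iff matched_star_root_def using star by blast
  finally show ?thesis .
qed

end

lemma INF_enat_le_iff: "(INF x\<in>A. enat (f x)) \<le> enat n \<longleftrightarrow> (\<exists>x\<in>A. f x \<le> n)"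
proof -
  have "(INF x\<in>A. enat (f x)) \<le> enat n \<longleftrightarrow> (INF x\<in>A. enat (f x)) < enat (Suc n)"
    by (cases "INF x\<in>A. enat (f x)") auto
  then show ?thesis
    by (simp only: INF_less_iff enat_ord_simps less_Suc_eq_le)
qed

lemma td_le_iff:
  "td G \<le> enat n \<longleftrightarrow> (\<exists>r ts. elimination_tree G (Node r ts) \<and> depth (Node r ts) \<le> n)"
  by (simp add: td_def INF_enat_le_iff ex_rtree_iff)

lemma mtd_le_iff:
  "mtd G \<le> enat n \<longleftrightarrow> (\<exists>r ts. matched_elimination_tree G (Node r ts) \<and> depth (Node r ts) \<le> n)"
  by (simp add: mtd_def INF_enat_le_iff ex_rtree_iff)

lemma td_le_mtd: "td G \<le> mtd G"
  unfolding td_def mtd_def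
  by (rule INF_superset_mono) (auto simp: matched_elimination_tree_def)

context graph
begin

lemma td_le_1_iff:
  assumes "connected G"
  shows "td G \<le> 1 \<longleftrightarrow> is_singleton (verts G)"
  using assms td_le_iff[of G 1] ex_elimination_tree_Node_depth_le_1_iff
  by (simp add: is_singleton_def one_enat_def)

lemma td_le_3_iff: "connected G \<Longrightarrow> td G \<le> 3 \<longleftrightarrow> (\<exists>r. star_root G r)"
  using td_le_iff[of G 3] ex_elimination_tree_Node_depth_le_3_iff by (simp add: numeral_eq_enat)

lemma mtd_le_3_iff:
  "connected G \<Longrightarrow> mtd G \<le> 3 \<longleftrightarrow> (\<exists>r. verts G \<noteq> {r} \<and> matched_star_root G r)"
  using mtd_le_iff[of G 3] ex_matched_elimination_tree_Node_depth_le_3_iff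
  by (simp add: numeral_eq_enat)

end

subsection \<open>Induced subgraphs\<close>

lemma (in wf_digraph) dominates_app_iso_iff:
  assumes "digraph_isomorphism hom" "u \<in> verts G" "v \<in> verts G"
  shows "iso_verts hom u \<rightarrow>\<^bsub>app_iso hom G\<^esub> iso_verts hom v \<longleftrightarrow> u \<rightarrow> v"
proof -
  have "a = u \<and> b = v"
    if "a \<rightarrow> b" "iso_verts hom a = iso_verts hom u" "iso_verts hom b = iso_verts hom v" for a b
    using that assms adj_in_verts iso_verts_eq_iff by metis
  then show ?thesis
    by (force simp: arcs_ends_app_iso_eq[OF assms(1)])
qed

lemma (in nomulti_digraph) bij_betw_arc_to_ends: "bij_betw (arc_to_ends G) (arcs G) (arcs_ends G)"
  by (simp add: bij_betw_def arcs_ends_def inj_on_arc_to_ends)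

lemma digraph_isoI_dominates:
  assumes "nomulti_digraph G" "nomulti_digraph H" and bij: "bij_betw f (verts G) (verts H)"
    and dom: "\<And>u v. u \<in> verts G \<Longrightarrow> v \<in> verts G \<Longrightarrow> f u \<rightarrow>\<^bsub>H\<^esub> f v \<longleftrightarrow> u \<rightarrow>\<^bsub>G\<^esub> v"
  shows "digraph_iso G H"
proof -
  interpret G: nomulti_digraph G by fact
  interpret H: nomulti_digraph H by fact
  have bij_ends: "bij_betw (map_prod f f) (arcs_ends G) (arcs_ends H)"
  proof (rule bij_betw_imageI)
    have "inj_on (map_prod f f) (verts G \<times> verts G)"
      using bij by (intro map_prod_inj_on bij_betw_imp_inj_on)
    then show "inj_on (map_prod f f) (arcs_ends G)"
      by (rule inj_on_subset) (auto dest: G.adj_in_verts)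
    show "map_prod f f ` arcs_ends G = arcs_ends H"
    proof (intro equalityI subrelI)
      show "x \<rightarrow>\<^bsub>H\<^esub> y" if "(x, y) \<in> map_prod f f ` arcs_ends G" for x y
        using that dom G.adj_in_verts by auto
      show "(x, y) \<in> map_prod f f ` arcs_ends G" if xy: "x \<rightarrow>\<^bsub>H\<^esub> y" for x y
      proof -
        obtain u v where "u \<in> verts G" "v \<in> verts G" "x = f u" "y = f v"
          using H.adj_in_verts[OF xy] bij unfolding bij_betw_def by (metis imageE)
        then show ?thesis
          using dom xy by force
      qed
    qed
  qed
  define g where "g = inv_into (arcs H) (arc_to_ends H) \<circ> (map_prod f f \<circ> arc_to_ends G)"
  have bij_g: "bij_betw g (arcs G) (arcs H)"
    unfolding g_def using bij_ends G.bij_betw_arc_to_ends H.bij_betw_arc_to_ends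
    by (auto intro: bij_betw_trans bij_betw_inv_into)
  have "arc_to_ends H (g a) = map_prod f f (arc_to_ends G a)" if "a \<in> arcs G" for a
    using that bij_ends G.bij_betw_arc_to_ends H.bij_betw_arc_to_ends
    by (simp add: g_def bij_betw_inv_into_right bij_betw_apply)
  then show ?thesis
    using bij bij_g G.wf_digraph unfolding digraph_iso_def
    by (intro exI[of _ "\<lparr> iso_verts = f, iso_arcs = g, iso_head = head H, iso_tail = tail H \<rparr>"])
      (auto simp: G.digraph_isomorphism_def app_iso_def bij_betw_def arc_to_ends_def)
qed

lemma digraph_iso_iff_dominates:
  assumes "nomulti_digraph G" "nomulti_digraph H"
  shows "digraph_iso G H \<longleftrightarrow> (\<exists>f. bij_betw f (verts G) (verts H) \<and>
    (\<forall>u\<in>verts G. \<forall>v\<in>verts G. f u \<rightarrow>\<^bsub>H\<^esub> f v \<longleftrightarrow> u \<rightarrow>\<^bsub>G\<^esub> v))"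
proof
  interpret G: nomulti_digraph G by fact
  assume "digraph_iso G H"
  then obtain hom where hom: "G.digraph_isomorphism hom" and H: "H = app_iso hom G"
    by (auto simp: digraph_iso_def)
  then show "\<exists>f. bij_betw f (verts G) (verts H) \<and>
      (\<forall>u\<in>verts G. \<forall>v\<in>verts G. f u \<rightarrow>\<^bsub>H\<^esub> f v \<longleftrightarrow> u \<rightarrow>\<^bsub>G\<^esub> v)"
    using G.dominates_app_iso_iff G.digraph_isomorphism_inj_on_verts
    by (intro exI[of _ "iso_verts hom"]) (auto simp: bij_betw_def)
qed (metis assms digraph_isoI_dominates)

lemma contains_induced_iff:
  assumes "graph G" "nomulti_digraph F"
  shows "contains_induced G F \<longleftrightarrow> (\<exists>f. inj_on f (verts F) \<and> f ` verts F \<subseteq> verts G \<and>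
    (\<forall>i\<in>verts F. \<forall>j\<in>verts F. f i \<rightarrow>\<^bsub>G\<^esub> f j \<longleftrightarrow> i \<rightarrow>\<^bsub>F\<^esub> j))"
proof -
  interpret G: graph G by fact
  interpret F: nomulti_digraph F by fact
  have iso: "digraph_iso H F \<longleftrightarrow> (\<exists>f. bij_betw f (verts F) (verts H) \<and>
      (\<forall>i\<in>verts F. \<forall>j\<in>verts F. f i \<rightarrow>\<^bsub>G\<^esub> f j \<longleftrightarrow> i \<rightarrow>\<^bsub>F\<^esub> j))"
    if H: "induced_subgraph H G" for H
  proof -
    interpret H: graph H
      using H by (rule G.graphI_induced)
    have "digraph_iso H F \<longleftrightarrow> digraph_iso F H"
      using digraph_iso_swap[OF H.wf_digraph] digraph_iso_swap[OF F.wf_digraph] by metis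
    also have "\<dots> \<longleftrightarrow> (\<exists>f. bij_betw f (verts F) (verts H) \<and>
        (\<forall>i\<in>verts F. \<forall>j\<in>verts F. f i \<rightarrow>\<^bsub>H\<^esub> f j \<longleftrightarrow> i \<rightarrow>\<^bsub>F\<^esub> j))"
      using F.nomulti_digraph H.nomulti_digraph by (rule digraph_iso_iff_dominates)
    finally show ?thesis
      by (simp add: induced_subgraph_dominates_iff[OF H] bij_betw_apply cong: conj_cong)
  qed
  show ?thesis
  proof
    assume "contains_induced G F"
    then show "\<exists>f. inj_on f (verts F) \<and> f ` verts F \<subseteq> verts G \<and>
        (\<forall>i\<in>verts F. \<forall>j\<in>verts F. f i \<rightarrow>\<^bsub>G\<^esub> f j \<longleftrightarrow> i \<rightarrow>\<^bsub>F\<^esub> j)"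
      using iso subgraph_imp_subverts[OF induced_imp_subgraph]
      unfolding contains_induced_def bij_betw_def by metis
  next
    assume "\<exists>f. inj_on f (verts F) \<and> f ` verts F \<subseteq> verts G \<and>
      (\<forall>i\<in>verts F. \<forall>j\<in>verts F. f i \<rightarrow>\<^bsub>G\<^esub> f j \<longleftrightarrow> i \<rightarrow>\<^bsub>F\<^esub> j)"
    then obtain f where f: "inj_on f (verts F)" "f ` verts F \<subseteq> verts G"
      "\<forall>i\<in>verts F. \<forall>j\<in>verts F. f i \<rightarrow>\<^bsub>G\<^esub> f j \<longleftrightarrow> i \<rightarrow>\<^bsub>F\<^esub> j"
      by blast
    then have "induced_subgraph (G \<restriction> (f ` verts F)) G"
      by blast
    then show "contains_induced G F"
      using iso f unfolding contains_induced_def bij_betw_def by (metis induce_subgraph_verts)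
  qed
qed

lemma contains_induced_iff_nth:
  assumes "graph G" "graph F" "verts F = {0..<n}"
  shows "contains_induced G F \<longleftrightarrow> (\<exists>vs. length vs = n \<and> distinct vs \<and> set vs \<subseteq> verts G \<and>
    (\<forall>j<n. \<forall>i<j. vs ! i \<rightarrow>\<^bsub>G\<^esub> vs ! j \<longleftrightarrow> i \<rightarrow>\<^bsub>F\<^esub> j))"
proof -
  interpret G: graph G by fact
  interpret F: graph F by fact
  have "contains_induced G F \<longleftrightarrow> (\<exists>f. inj_on f {0..<n} \<and> f ` {0..<n} \<subseteq> verts G \<and>
      (\<forall>i\<in>{0..<n}. \<forall>j\<in>{0..<n}. f i \<rightarrow>\<^bsub>G\<^esub> f j \<longleftrightarrow> i \<rightarrow>\<^bsub>F\<^esub> j))"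
    using contains_induced_iff[OF assms(1) F.nomulti_digraph] assms(3) by simp
  also have "\<dots> \<longleftrightarrow> (\<exists>vs. length vs = n \<and> distinct vs \<and> set vs \<subseteq> verts G \<and>
      (\<forall>j<n. \<forall>i<j. vs ! i \<rightarrow>\<^bsub>G\<^esub> vs ! j \<longleftrightarrow> i \<rightarrow>\<^bsub>F\<^esub> j))" (is "?fun \<longleftrightarrow> ?list")
  proof
    assume ?fun
    then obtain f where "inj_on f {0..<n}" "f ` {0..<n} \<subseteq> verts G"
      "\<forall>i\<in>{0..<n}. \<forall>j\<in>{0..<n}. f i \<rightarrow>\<^bsub>G\<^esub> f j \<longleftrightarrow> i \<rightarrow>\<^bsub>F\<^esub> j"
      by blast
    then show ?list
      by (intro exI[of _ "map f [0..<n]"]) (simp add: distinct_map)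
  next
    assume ?list
    then obtain vs where vs: "length vs = n" "distinct vs" "set vs \<subseteq> verts G"
      and dom: "\<forall>j<n. \<forall>i<j. vs ! i \<rightarrow>\<^bsub>G\<^esub> vs ! j \<longleftrightarrow> i \<rightarrow>\<^bsub>F\<^esub> j"
      by blast
    have "vs ! i \<rightarrow>\<^bsub>G\<^esub> vs ! j \<longleftrightarrow> i \<rightarrow>\<^bsub>F\<^esub> j" if "i < n" "j < n" for i j
      using dom that G.adj_not_same F.adj_not_same G.dominates_commute F.dominates_commute
      by (metis linorder_less_linear)
    then show ?fun
      using vs by (intro exI[of _ "(!) vs"]) (auto simp: inj_on_nth)
  qed
  finally show ?thesis .
qed

lemma dominates_simple_graph_iff: "u \<rightarrow>\<^bsub>simple_graph V E\<^esub> v \<longleftrightarrow> (u, v) \<in> E \<or> (v, u) \<in> E"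
  by (simp add: simple_graph_def)

lemma graph_simple_graph:
  assumes "finite V" "E \<subseteq> V \<times> V" "irrefl E"
  shows "graph (simple_graph V E)"
proof -
  have "finite E"
    using assms(1,2) by (meson finite_SigmaI finite_subset)
  then show ?thesis
    using assms
    by unfold_locales
      (auto simp: simple_graph_def symmetric_def arc_to_ends_def irrefl_def intro: symI)
qed

lemma contains_induced_simple_graph_iff:
  assumes "graph G" "E \<subseteq> {0..<n} \<times> {0..<n}" "irrefl E"
  shows "contains_induced G (simple_graph {0..<n} E) \<longleftrightarrow>
    (\<exists>vs. length vs = n \<and> distinct vs \<and> set vs \<subseteq> verts G \<and>
      (\<forall>j<n. \<forall>i<j. vs ! i \<rightarrow>\<^bsub>G\<^esub> vs ! j \<longleftrightarrow> (i, j) \<in> E \<or> (j, i) \<in> E))"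
  using contains_induced_iff_nth[OF assms(1) graph_simple_graph[OF _ assms(2,3)]]
  unfolding dominates_simple_graph_iff by (simp add: simple_graph_def)

text \<open>
  For each pair of vertices of the list, only the arc from the earlier to the later one is
  constrained, which suffices as the notion is meant for symmetric graphs.
\<close>

fun induced_path :: "('a, 'b) pre_digraph \<Rightarrow> 'a list \<Rightarrow> bool" where
  "induced_path G [] \<longleftrightarrow> True"
| "induced_path G [v] \<longleftrightarrow> v \<in> verts G"
| "induced_path G (u # v # vs) \<longleftrightarrow>
    u \<rightarrow>\<^bsub>G\<^esub> v \<and> (\<forall>w\<in>set vs. w \<noteq> u \<and> \<not> u \<rightarrow>\<^bsub>G\<^esub> w) \<and> induced_path G (v # vs)"

lemma ex_length_Suc: "(\<exists>xs. length xs = Suc n \<and> P xs) \<longleftrightarrow> (\<exists>x xs. length xs = n \<and> P (x # xs))"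
  by (metis length_Suc_conv)

context graph
begin

lemma contains_induced_C4_iff:
  "contains_induced G C4 \<longleftrightarrow>
    (\<exists>a b c d. induced_path G [a, b, c] \<and> induced_path G [a, d, c] \<and> b \<noteq> d \<and> \<not> b \<rightarrow> d)"
  unfolding C4_def using adj_in_verts adj_not_same dominates_commute
  by (subst contains_induced_simple_graph_iff[OF graph_axioms])
    (auto simp: irrefl_def numeral_eq_Suc All_less_Suc ex_length_Suc simp del: ex_simps
      intro!: iff_exI)

lemma contains_induced_P6_iff:
  "contains_induced G P6 \<longleftrightarrow> (\<exists>a b c d e f. induced_path G [a, b, c, d, e, f])"
  unfolding P6_def using adj_in_verts adj_not_same dominates_commute
  by (subst contains_induced_simple_graph_iff[OF graph_axioms])
    (auto simp: irrefl_def numeral_eq_Suc All_less_Suc ex_length_Suc simp del: ex_simps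
      intro!: iff_exI)

lemma contains_induced_T33_iff:
  "contains_induced G T33 \<longleftrightarrow>
    (\<exists>a b c x y z. b \<rightarrow> c \<and> induced_path G [b, a, x, y, z] \<and> induced_path G [c, a, x, y, z])"
  unfolding T33_def using adj_in_verts adj_not_same dominates_commute
  by (subst contains_induced_simple_graph_iff[OF graph_axioms])
    (auto simp: irrefl_def numeral_eq_Suc All_less_Suc ex_length_Suc simp del: ex_simps
      intro!: iff_exI)

end

subsection \<open>Matched roots and the forbidden subgraphs\<close>

context graph
begin

lemma matched_star_root_dominates_middle:
  assumes "matched_star_root G r" "u \<rightarrow> v" "v \<rightarrow> w" "u \<noteq> w" "r \<notin> {u, v, w}"
  shows "r \<rightarrow> v"
proof -
  interpret vertex_deletion G r
    by unfold_locales
  obtain C where C: "C \<in> comps" "u \<rightarrow>\<^bsub>C\<^esub> v"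
    using ex_comp_dominates assms(2,5) by blast
  then have "v \<rightarrow>\<^bsub>C\<^esub> w"
    using comp_dominates_iff comp_closed assms(3,5) by blast
  moreover obtain c where "star_center C c" "r \<rightarrow> c"
    using assms(1) C(1) unfolding matched_star_root_def by blast
  ultimately show ?thesis
    using C(2) assms(4) unfolding star_center_def by metis
qed

lemma matched_star_root_meets_walk:
  assumes "matched_star_root G r" "a \<rightarrow> b" "b \<rightarrow> c" "c \<rightarrow> d" "a \<noteq> c" "b \<noteq> d"
  shows "r \<in> {a, b, c, d}"
proof (rule ccontr)
  assume r: "r \<notin> {a, b, c, d}"
  interpret vertex_deletion G r
    by unfold_locales
  obtain C where C: "C \<in> comps" "a \<rightarrow>\<^bsub>C\<^esub> b"
    using ex_comp_dominates assms(2) r by blast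
  then have "b \<rightarrow>\<^bsub>C\<^esub> c" "c \<rightarrow>\<^bsub>C\<^esub> d"
    using comp_dominates_iff comp_closed assms(3,4) r by blast+
  moreover obtain s where "star_center C s"
    using assms(1) C(1) unfolding matched_star_root_def by blast
  ultimately show False
    using C(2) assms(3,5,6) adj_not_same unfolding star_center_def by metis
qed

lemma matched_star_root_not_contains_C4:
  assumes "matched_star_root G r"
  shows "\<not> contains_induced G C4"
proof
  assume "contains_induced G C4"
  then obtain a b c d where path: "induced_path G [a, b, c]" "induced_path G [a, d, c]"
    and bd: "b \<noteq> d" "\<not> b \<rightarrow> d"
    by (auto simp: contains_induced_C4_iff)
  then have cycle: "a \<rightarrow> b" "b \<rightarrow> c" "c \<rightarrow> d" "d \<rightarrow> a" and diag: "a \<noteq> c" "\<not> a \<rightarrow> c"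
    by (auto simp: dominates_commute)
  then have "r \<in> {a, b, c, d}"
    using matched_star_root_meets_walk[OF assms cycle(1-3)] bd by blast
  moreover have "r \<noteq> a"
    using matched_star_root_dominates_middle[OF assms cycle(2,3)] cycle diag bd adj_not_same
    by blast
  moreover have "r \<noteq> b"
    using matched_star_root_dominates_middle[OF assms cycle(3,4)] cycle diag bd adj_not_same
    by blast
  moreover have "r \<noteq> c"
    using matched_star_root_dominates_middle[OF assms cycle(4,1)] cycle diag bd adj_not_same
      dominates_commute by blast
  moreover have "r \<noteq> d"
    using matched_star_root_dominates_middle[OF assms cycle(1,2)] cycle diag bd adj_not_same
      dominates_commute by blast
  ultimately show False
    by blast
qed

lemma matched_star_root_not_contains_P6:
  assumes "matched_star_root G r"
  shows "\<not> contains_induced G P6"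
proof
  assume "contains_induced G P6"
  then obtain a b c d e f where path: "induced_path G [a, b, c, d, e, f]"
    by (auto simp: contains_induced_P6_iff)
  then have "r \<in> {a, b, c, d}" "r \<in> {c, d, e, f}"
    using matched_star_root_meets_walk[OF assms, of a b c d]
      matched_star_root_meets_walk[OF assms, of c d e f] by auto
  then consider (third) "r = c" | (fourth) "r = d"
    using path by auto
  then show False
  proof cases
    case third
    then show False
      using matched_star_root_dominates_middle[OF assms, of d e f] path by auto
  next
    case fourth
    then show False
      using matched_star_root_dominates_middle[OF assms, of a b c] path
      by (auto simp: dominates_commute)
  qed
qed

lemma matched_star_root_not_contains_T33:
  assumes "matched_star_root G r"
  shows "\<not> contains_induced G T33"
proof
  assume "contains_induced G T33"
  then obtain a b c x y z
    where path: "induced_path G [b, a, x, y, z]" "induced_path G [c, a, x, y, z]" and "b \<rightarrow> c"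
    by (auto simp: contains_induced_T33_iff)
  then have "a \<rightarrow> b" "b \<rightarrow> c" "c \<rightarrow> a"
    by (auto simp: dominates_commute)
  then have "r \<in> {a, b, c}"
    using matched_star_root_meets_walk[OF assms, of a b c a] adj_not_same by blast
  moreover have "r \<in> {a, x, y, z}"
    using matched_star_root_meets_walk[OF assms, of a x y z] path by auto
  ultimately have "r = a"
    using path by auto
  then show False
    using matched_star_root_dominates_middle[OF assms, of x y z] path by auto
qed

subsection \<open>Moving the root\<close>

lemma unmatched_star_component_induced_path:
  assumes "connected G" "r \<in> verts G" and C: "C \<in> components (del_vert r)"
    and center: "star_center C c" and unmatched: "\<And>s. star_center C s \<Longrightarrow> \<not> r \<rightarrow> s"
    and "\<not> contains_induced G C4"
  obtains l l' where "induced_path G [r, l, c, l']" "l \<in> verts C" "l' \<in> verts C"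
    "\<And>v. v \<in> verts C \<Longrightarrow> r \<rightarrow> v \<longleftrightarrow> v = l"
proof -
  interpret vertex_deletion G r
    by unfold_locales
  note edge = comp_star_center_dominates_iff[OF C center]
  have c: "c \<in> verts C" "\<not> r \<rightarrow> c"
    using center unmatched by (auto simp: star_center_def)
  obtain l where l: "l \<in> verts C" "r \<rightarrow> l"
    using ex_dominated_in_comp[OF assms(1,2) C] by blast
  have unique: "v = l" if v: "v \<in> verts C" "r \<rightarrow> v" for v
  proof (rule ccontr)
    assume "v \<noteq> l"
    then have "induced_path G [r, l, c]" "induced_path G [r, v, c]" "\<not> l \<rightarrow> v"
      using edge l v c comp_subset[OF C] by auto
    then show False
      using \<open>v \<noteq> l\<close> \<open>\<not> contains_induced G C4\<close> contains_induced_C4_iff by metis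
  qed
  have "\<not> star_center C l"
    using unmatched l(2) by blast
  then obtain u v where uv: "u \<in> verts C" "v \<in> verts C" "u \<rightarrow> v" "u \<noteq> l" "v \<noteq> l"
    using l(1) by (auto simp: star_center_def comp_dominates_iff[OF C])
  then obtain l' where l': "l' \<in> verts C" "l' \<noteq> l" "l' \<noteq> c"
    using edge[OF uv(1,2)] by (cases "u = c") auto
  have "l \<noteq> c" "r \<notin> verts C" "l' \<in> verts G"
    using l c l' comp_subset[OF C] by auto
  moreover have "\<not> r \<rightarrow> l'"
    using unique l' by blast
  ultimately have "induced_path G [r, l, c, l']"
    using edge[OF l(1) c(1)] edge[OF c(1) l'(1)] edge[OF l(1) l'(1)] l l' c by auto
  then show ?thesis
    using that l l' unique by blast
qed

lemma contains_induced_P6_or_T33: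
  assumes "connected G" "r \<in> verts G"
    and C: "C \<in> components (del_vert r)" and D: "D \<in> components (del_vert r)" and "C \<noteq> D"
    and nontrivial: "\<not> is_singleton (verts D)"
    and path: "induced_path G [r, x, y, z]" "{x, y, z} \<subseteq> verts C"
  shows "contains_induced G P6 \<or> contains_induced G T33"
proof -
  interpret vertex_deletion G r
    by unfold_locales
  interpret D: graph D
    using D by (rule comp_graph)
  have separated: "u \<noteq> v \<and> \<not> u \<rightarrow> v" if "u \<in> verts D" "v \<in> verts C" for u v
    using comp_separated[OF D C] \<open>C \<noteq> D\<close> that by blast
  have extend: "induced_path G [d, r, x, y, z]" if "d \<in> verts D" "d \<rightarrow> r" for d
    using that path separated by auto
  obtain d where d: "d \<in> verts D" "r \<rightarrow> d"
    using ex_dominated_in_comp[OF assms(1,2) D] by blast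
  obtain d' where d': "d' \<in> verts D" "d \<rightarrow> d'"
    using D.ex_dominates_if_connected[OF comp_connected[OF D] nontrivial d(1)]
    unfolding comp_dominates_iff[OF D] by blast
  show ?thesis
  proof (cases "d' \<rightarrow> r")
    case True
    then show ?thesis
      using extend d d' dominates_commute contains_induced_T33_iff by metis
  next
    case False
    have "d' \<noteq> r"
      using comp_subset[OF D] d'(1) by blast
    then have "induced_path G [d', d, r, x, y, z]"
      using False extend[OF d(1)] d d' path(2) separated
      by (auto simp: dominates_commute)
    then show ?thesis
      using contains_induced_P6_iff by metis
  qed
qed

lemma matched_star_rootI:
  assumes "l \<in> verts G" and center: "\<And>s. s \<in> S \<Longrightarrow> l \<rightarrow> s"
    and indep: "\<And>s s'. s \<in> S \<Longrightarrow> s' \<in> S \<Longrightarrow> \<not> s \<rightarrow> s'"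
    and leaf: "\<And>v. v \<in> verts G - insert l S \<Longrightarrow> \<exists>s\<in>S. \<forall>u. u \<noteq> l \<longrightarrow> (v \<rightarrow> u \<longleftrightarrow> u = s)"
  shows "matched_star_root G l"
proof -
  interpret vertex_deletion G l
    by unfold_locales
  have "l \<notin> S"
    using center adj_not_same by blast
  have "\<exists>s\<in>S. star_center C s" if "C \<in> comps" for C
  proof (rule del.ex_star_center_component)
    show "\<not> s \<rightarrow>\<^bsub>del_vert l\<^esub> s'" if "s \<in> S" "s' \<in> S" for s s'
      using indep[OF that] by (simp add: dominates_del_vert_iff)
    show "\<exists>s\<in>S. \<forall>u. v \<rightarrow>\<^bsub>del_vert l\<^esub> u \<longleftrightarrow> u = s" if "v \<in> verts (del_vert l) - S" for v
      using leaf[of v] that \<open>l \<notin> S\<close> unfolding dominates_del_vert_iff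
      by (metis DiffD1 DiffD2 DiffI insertE singletonI verts_del_vert)
  qed (rule that)
  then show ?thesis
    using assms(1) center unfolding matched_star_root_def by blast
qed

lemma matched_star_root_at_leaf:
  assumes "connected G" "r \<in> verts G"
    and C: "C \<in> components (del_vert r)" and center: "star_center C c"
    and l: "l \<in> verts C" "l \<noteq> c" "\<And>v. v \<in> verts C \<Longrightarrow> r \<rightarrow> v \<longleftrightarrow> v = l"
    and singleton: "\<And>D. D \<in> components (del_vert r) \<Longrightarrow> D \<noteq> C \<Longrightarrow> is_singleton (verts D)"
  shows "matched_star_root G l"
proof (rule matched_star_rootI)
  interpret vertex_deletion G r
    by unfold_locales
  note edge = comp_star_center_dominates_iff[OF C center]
  have c: "c \<in> verts C"
    using center by (simp add: star_center_def)
  show "l \<in> verts G"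
    using l(1) comp_subset[OF C] by blast
  show "l \<rightarrow> s" if "s \<in> {r, c}" for s
    using that l edge[OF l(1) c] dominates_commute by blast
  show "\<not> s \<rightarrow> s'" if "s \<in> {r, c}" "s' \<in> {r, c}" for s s'
    using that l(2,3) c dominates_commute adj_not_same by blast
  show "\<exists>s\<in>{r, c}. \<forall>u. u \<noteq> l \<longrightarrow> (v \<rightarrow> u \<longleftrightarrow> u = s)" if v: "v \<in> verts G - insert l {r, c}" for v
  proof (cases "v \<in> verts C")
    case True
    then have "v \<rightarrow> u \<longleftrightarrow> u = c" for u
      using comp_closed[OF C True] edge[OF True] l(3) c v dominates_commute
      by (metis DiffD2 insertCI)
    then show ?thesis
      by blast
  next
    case False
    obtain D where D: "D \<in> comps" "v \<in> verts D"
      using ex_comp v by blast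
    then have "verts D = {v}"
      using singleton False by (metis is_singletonE singletonD)
    then show ?thesis
      using singleton_comp_dominates_iff[OF assms(1,2) D(1)] by blast
  qed
qed

lemma ex_matched_star_root:
  assumes "connected G" "star_root G r"
    and "\<not> contains_induced G C4" "\<not> contains_induced G P6" "\<not> contains_induced G T33"
  shows "\<exists>q. matched_star_root G q"
proof (cases "matched_star_root G r")
  case False
  have r: "r \<in> verts G"
    using assms(2) by (simp add: star_root_def)
  then obtain C where C: "C \<in> components (del_vert r)"
    and unmatched: "\<And>s. star_center C s \<Longrightarrow> \<not> r \<rightarrow> s"
    using False by (auto simp: matched_star_root_def)
  obtain c where c: "star_center C c"
    using assms(2) C by (auto simp: star_root_def)
  obtain l l' where path: "induced_path G [r, l, c, l']" "l \<in> verts C" "l' \<in> verts C"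
    and l: "\<And>v. v \<in> verts C \<Longrightarrow> r \<rightarrow> v \<longleftrightarrow> v = l"
    using unmatched_star_component_induced_path[OF assms(1) r C c unmatched assms(3)] by metis
  have "is_singleton (verts D)" if "D \<in> components (del_vert r)" "D \<noteq> C" for D
    using contains_induced_P6_or_T33[OF assms(1) r C that(1) _ _ path(1)] that(2) path c assms(4,5)
    by (auto simp: star_center_def)
  moreover have "l \<noteq> c"
    using path(1) adj_not_same by auto
  ultimately show ?thesis
    using matched_star_root_at_leaf[OF assms(1) r C c path(2) _ l] by blast
qed blast

lemma ex_matched_star_root_iff:
  assumes "connected G" "star_root G r"
  shows "(\<exists>q. matched_star_root G q) \<longleftrightarrow>
    \<not> contains_induced G C4 \<and> \<not> contains_induced G P6 \<and> \<not> contains_induced G T33"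
  using matched_star_root_not_contains_C4 matched_star_root_not_contains_P6
    matched_star_root_not_contains_T33 ex_matched_star_root[OF assms]
  by blast

end

theorem theorem5:
  fixes G :: "('a, 'b) pre_digraph"
  assumes "graph G"
    and "connected G"
    and "td G = 3"
  shows "mtd G = 3 \<longleftrightarrow>
    \<not> contains_induced G C4 \<and> \<not> contains_induced G P6 \<and> \<not> contains_induced G T33"
proof -
  interpret graph G by fact
  obtain r where "star_root G r"
    using td_le_3_iff[OF assms(2)] assms(3) by auto
  have "\<not> is_singleton (verts G)"
    using td_le_1_iff[OF assms(2)] assms(3) by simp
  have "mtd G = 3 \<longleftrightarrow> mtd G \<le> 3"
    using td_le_mtd[of G] assms(3) by auto
  also have "\<dots> \<longleftrightarrow> (\<exists>q. matched_star_root G q)"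
    using mtd_le_3_iff[OF assms(2)] \<open>\<not> is_singleton (verts G)\<close> by (auto simp: is_singleton_def)
  also have "\<dots> \<longleftrightarrow>
      \<not> contains_induced G C4 \<and> \<not> contains_induced G P6 \<and> \<not> contains_induced G T33"
    using assms(2) \<open>star_root G r\<close> by (rule ex_matched_star_root_iff)
  finally show ?thesis .
qed

end
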